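(* Let $Q, M, k \geq 1$ be integers, let $U = \{0,\dots,Q-1\}\times\{0,\dots,M-1\}$, and let $\mathbf{F} \in \mathbb{R}^{U\times k}$ be arbitrary feature maps. Let $\mu(\mathbf{m},\mathcal{C})$ be the stationary Gaussian model associated with $\mathbf{F}$, with mean $\mathbf{m}\in\mathbb{R}^k$ and covariance $\mathcal{C}\in\mathbb{R}^{U\times k\times k}$. Then the Gram matrix $\mathcal{G}$, centred Gram matrix $\bar{\mathcal{G}}$, (modified, periodic) correlation $\mathcal{S}$ and spectrum $\mathcal{F}$ of $\mathbf{F}$ can be derived from this stationary Gaussian model as follows: \begin{align*} \mathcal{G} &= \mathcal{C}(0) + \mathbf{m}\mathbf{m}^T,\\ \bar{\mathcal{G}} &= \mathcal{C}(0),\\ \forall p\in U,\quad \mathcal{S}(p) &= \mathrm{diag}(\mathcal{C}(p)) + \mathbf{m}\odot\mathbf{m},\\ \forall \omega\in U,\quad \mathcal{F}(\omega) &= \big(|U|\,|\hat{\mathcal{S}}(\omega)|\big)^{1/2}, \end{align*} where in the last identity the absolute value and square root are taken componentwise over the $k$ channels.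
   Context: $|U| = QM$ is the number of points of the grid $U$. Sums $p+p'$ of grid points are taken with periodic boundary conditions, i.e. modulo $(Q,M)$. For $p \in U$ and $1\le i\le k$, $\mathbf{F}(p,i)\in\mathbb{R}$ is the value of channel $i$ at location $p$, and $\mathbf{F}(p)\in\mathbb{R}^k$ is the vector of all channels at $p$. The following quantities are associated with $\mathbf{F}$ (all with $p\in U$, $1\le i,j,n\le k$). Stationary Gaussian model $\mu(\mathbf{m},\mathcal{C})$: the mean is $\mathbf{m} = \frac{1}{|U|}\sum_{p\in U}\mathbf{F}(p)\in\mathbb{R}^k$ with components $\mathbf{m}_i$, and the covariance is $$\mathcal{C}(p,i,j) = \frac{1}{|U|}\sum_{p'\in U}\big(\mathbf{F}(p',i)-\mathbf{m}_i\big)\big(\mathbf{F}(p+p',j)-\mathbf{m}_j\big),$$ so that $\mathcal{C}(p)$ is a $k\times k$ matrix for each $p\in U$. Gram matrix: $\mathcal{G}(i,j) = \frac{1}{|U|}\sum_{p\in U}\mathbf{F}(p,i)\mathbf{F}(p,j)$. Centred Gram matrix: $\bar{\mathcal{G}}(i,j) = \frac{1}{|U|}\sum_{p\in U}\big(\mathbf{F}(p,i)-\mathbf{m}_i\big)\big(\mathbf{F}(p,j)-\mathbf{m}_j\big)$. (Modified) correlation: $\mathcal{S}(p,n) = \frac{1}{|U|}\sum_{p'\in U}\mathbf{F}(p',n)\mathbf{F}(p+p',n)$; $\mathcal{S}(p)\in\mathbb{R}^k$ is the vector $(\mathcal{S}(p,n))_{n=1}^k$. Spectrum: $\mathcal{F}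 = |\hat{\mathbf{F}}|$, i.e. $\mathcal{F}(\omega,n) = |\hat{\mathbf{F}}(\omega,n)|$ for $\omega\in U$, $1\le n\le k$. Here $\hat{a}$ denotes the discrete Fourier transform on $U$ applied to each channel separately, without normalization: $\hat{a}(\omega,n) = \sum_{p=(p_1,p_2)\in U} a(p,n)\,e^{-2\pi \mathrm{i}(\omega_1p_1/Q+\omega_2p_2/M)}$ for $\omega=(\omega_1,\omega_2)\in U$. For a $k\times k$ matrix $A$, $\mathrm{diag}(A)\in\mathbb{R}^k$ is the vector of its diagonal entries; $^T$ is transpose (vectors in $\mathbb{R}^k$ are columns); $\odot$ is the componentwise product of vectors. *)

theory Defs
  imports "HOL-Analysis.Analysis"
begin

text \<open>
  Feature maps are functions on grid points with values in \<open>real ^ 'k\<close>, where the finite index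
  type \<open>'k\<close> stands for the set of the \<open>k\<close> channels; \<open>F p $ i\<close> is channel \<open>i\<close> at location \<open>p\<close>.
  Only the values of \<open>F\<close> on the grid enter the definitions below.
\<close>

definition grid :: "nat \<Rightarrow> nat \<Rightarrow> (nat \<times> nat) set" where
  "grid Q M = {0..<Q} \<times> {0..<M}"

definition grid_add :: "nat \<Rightarrow> nat \<Rightarrow> nat \<times> nat \<Rightarrow> nat \<times> nat \<Rightarrow> nat \<times> nat" where
  "grid_add Q M p p' = ((fst p + fst p') mod Q, (snd p + snd p') mod M)"

definition gauss_mean :: "nat \<Rightarrow> nat \<Rightarrow> (nat \<times> nat \<Rightarrow> real ^ 'k) \<Rightarrow> real ^ 'k" where
  "gauss_mean Q M F = (1 / real (card (grid Q M))) *\<^sub>R (\<Sum>p\<in>grid Q M. F p)"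

definition gauss_cov :: "nat \<Rightarrow> nat \<Rightarrow> (nat \<times> nat \<Rightarrow> real ^ 'k) \<Rightarrow> nat \<times> nat \<Rightarrow> real ^ 'k ^ 'k" where
  "gauss_cov Q M F p = (\<chi> i j. 1 / real (card (grid Q M)) *
     (\<Sum>p'\<in>grid Q M. (F p' $ i - gauss_mean Q M F $ i)
        * (F (grid_add Q M p p') $ j - gauss_mean Q M F $ j)))"

definition gram :: "nat \<Rightarrow> nat \<Rightarrow> (nat \<times> nat \<Rightarrow> real ^ 'k) \<Rightarrow> real ^ 'k ^ 'k" where
  "gram Q M F = (\<chi> i j. 1 / real (card (grid Q M)) * (\<Sum>p\<in>grid Q M. F p $ i * F p $ j))"

definition centred_gram :: "nat \<Rightarrow> nat \<Rightarrow> (nat \<times> nat \<Rightarrow> real ^ 'k) \<Rightarrow> real ^ 'k ^ 'k" where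
  "centred_gram Q M F = (\<chi> i j. 1 / real (card (grid Q M)) *
     (\<Sum>p\<in>grid Q M. (F p $ i - gauss_mean Q M F $ i) * (F p $ j - gauss_mean Q M F $ j)))"

definition correlation :: "nat \<Rightarrow> nat \<Rightarrow> (nat \<times> nat \<Rightarrow> real ^ 'k) \<Rightarrow> nat \<times> nat \<Rightarrow> real ^ 'k" where
  "correlation Q M F p = (\<chi> n. 1 / real (card (grid Q M)) *
     (\<Sum>p'\<in>grid Q M. F p' $ n * F (grid_add Q M p p') $ n))"

definition dft :: "nat \<Rightarrow> nat \<Rightarrow> (nat \<times> nat \<Rightarrow> real ^ 'k) \<Rightarrow> nat \<times> nat \<Rightarrow> complex ^ 'k" where
  "dft Q M a \<omega> = (\<chi> n. \<Sum>p\<in>grid Q M. complex_of_real (a p $ n) *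
     exp (- 2 * complex_of_real pi * \<i> *
       (of_nat (fst \<omega>) * of_nat (fst p) / of_nat Q + of_nat (snd \<omega>) * of_nat (snd p) / of_nat M)))"

definition spectrum :: "nat \<Rightarrow> nat \<Rightarrow> (nat \<times> nat \<Rightarrow> real ^ 'k) \<Rightarrow> nat \<times> nat \<Rightarrow> real ^ 'k" where
  "spectrum Q M F \<omega> = (\<chi> n. cmod (dft Q M F \<omega> $ n))"

definition diag :: "'a ^ 'k ^ 'k \<Rightarrow> 'a ^ 'k" where
  "diag A = (\<chi> i. A $ i $ i)"

end

(*
  Periodic translation permutes the grid.  Expanding the centred product defining the covariance
  therefore leaves the uncentred correlation minus the product of the means, which gives the first
  three identities; the last one is the Wiener-Khinchin identity: the DFT of the autocorrelation
  is, up to the factor 1/|U|, the squared modulus of the DFT.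
*)
theory Submission
  imports Defs "HOL-Number_Theory.Cong"
begin

lemma finite_grid [simp]: "finite (grid Q M)"
  by (simp add: grid_def)

lemma card_grid_pos: "Q \<ge> 1 \<Longrightarrow> M \<ge> 1 \<Longrightarrow> card (grid Q M) > 0"
  by (simp add: grid_def)

lemma grid_add_zero: "p \<in> grid Q M \<Longrightarrow> grid_add Q M (0, 0) p = p"
  by (auto simp: grid_def grid_add_def)

lemma grid_add_commute: "grid_add Q M p q = grid_add Q M q p"
  by (simp add: grid_add_def add.commute)

lemma inj_on_add_mod: "inj_on (\<lambda>x. (a + x) mod n) {0..<n}" for a n :: nat
proof (rule inj_onI)
  fix x y assume "x \<in> {0..<n}" "y \<in> {0..<n}" and eq: "(a + x) mod n = (a + y) mod n"
  then show "x = y"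
    using cong_add_lcancel_nat[of a x y n] by (simp add: cong_def)
qed

text \<open>Cancellation modulo \<open>Q\<close> and modulo \<open>M\<close> gives injectivity; an
  injective self-map of a finite set is onto.\<close>

lemma bij_betw_grid_add: "bij_betw (grid_add Q M p) (grid Q M) (grid Q M)"
proof -
  have sub: "grid_add Q M p ` grid Q M \<subseteq> grid Q M"
    by (auto simp: grid_def grid_add_def)
  have inj: "inj_on (grid_add Q M p) (grid Q M)"
  proof (rule inj_onI)
    fix q r assume "q \<in> grid Q M" "r \<in> grid Q M" and "grid_add Q M p q = grid_add Q M p r"
    then show "q = r"
      using inj_onD[OF inj_on_add_mod[of "fst p" Q], of "fst q" "fst r"]
        inj_onD[OF inj_on_add_mod[of "snd p" M], of "snd q" "snd r"]
      by (simp add: grid_def grid_add_def prod_eq_iff mem_Times_iff)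
  qed
  show ?thesis
    using sub inj endo_inj_surj[of "grid Q M"] by (simp add: bij_betw_def)
qed

lemma sum_grid_add: "(\<Sum>q\<in>grid Q M. g (grid_add Q M p q)) = (\<Sum>q\<in>grid Q M. g q)"
  by (rule sum.reindex_bij_betw[OF bij_betw_grid_add])

lemma sum_gauss_mean:
  assumes "Q \<ge> 1" "M \<ge> 1"
  shows "(\<Sum>p\<in>grid Q M. F p $ i) = real (card (grid Q M)) * gauss_mean Q M F $ i"
  using card_grid_pos[OF assms] by (simp add: gauss_mean_def)

text \<open>The shifted channel has the same mean as the original, so each cross term of the
  expanded product contributes minus the product of the means, and the constant term cancels one of
  the two. The Gram and correlation identities are both read off from this formula.\<close>

lemma gauss_cov_nth:
  assumes "Q \<ge> 1" "M \<ge> 1"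
  shows "gauss_cov Q M F p $ i $ j =
    1 / real (card (grid Q M)) * (\<Sum>q\<in>grid Q M. F q $ i * F (grid_add Q M p q) $ j)
      - gauss_mean Q M F $ i * gauss_mean Q M F $ j"
proof -
  let ?N = "real (card (grid Q M))" and ?a = "gauss_mean Q M F $ i" and ?b = "gauss_mean Q M F $ j"
  have N: "?N \<noteq> 0" using card_grid_pos[OF assms] by linarith
  have shift: "(\<Sum>q\<in>grid Q M. F (grid_add Q M p q) $ j) = ?N * ?b"
    using sum_grid_add[of "\<lambda>q. F q $ j" Q M p] sum_gauss_mean[OF assms, of F j] by simp
  have "(\<Sum>q\<in>grid Q M. (F q $ i - ?a) * (F (grid_add Q M p q) $ j - ?b))
      = (\<Sum>q\<in>grid Q M. F q $ i * F (grid_add Q M p q) $ j)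
        - (\<Sum>q\<in>grid Q M. F q $ i) * ?b - ?a * (\<Sum>q\<in>grid Q M. F (grid_add Q M p q) $ j)
        + ?N * (?a * ?b)"
    by (simp add: algebra_simps sum.distrib sum_subtractf sum_distrib_left sum_distrib_right)
  also have "\<dots> = (\<Sum>q\<in>grid Q M. F q $ i * F (grid_add Q M p q) $ j) - ?N * (?a * ?b)"
    by (simp add: shift sum_gauss_mean[OF assms])
  finally show ?thesis
    using N by (simp only: gauss_cov_def vec_lambda_beta) (simp add: right_diff_distrib)
qed

lemma gauss_cov_zero: "gauss_cov Q M F (0, 0) = centred_gram Q M F"
  by (simp add: gauss_cov_def centred_gram_def grid_add_zero cong: sum.cong)

lemma columnvector_mult_transpose_nth:
  "((columnvector m :: real ^ 1 ^ 'k) ** transpose (columnvector m)) $ i $ j = m $ i * m $ j"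
  by (simp add: matrix_matrix_mult_def columnvector_def transpose_def)

text \<open>The Fourier kernel of \<open>dft\<close>, isolated because the argument uses only that
  it is a unitary character of the group Z/Q x Z/M.\<close>

definition grid_character :: "nat \<Rightarrow> nat \<Rightarrow> nat \<times> nat \<Rightarrow> nat \<times> nat \<Rightarrow> complex" where
  "grid_character Q M \<omega> p = exp (- 2 * complex_of_real pi * \<i> *
     (of_nat (fst \<omega>) * of_nat (fst p) / of_nat Q + of_nat (snd \<omega>) * of_nat (snd p) / of_nat M))"

lemma dft_nth:
  "dft Q M a \<omega> $ n = (\<Sum>p\<in>grid Q M. of_real (a p $ n) * grid_character Q M \<omega> p)"
  by (simp add: dft_def grid_character_def)

lemma exp_two_pi_mod:
  fixes Q w x :: nat
  assumes "Q \<ge> 1"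
  shows "exp (- 2 * complex_of_real pi * \<i> * (of_nat w * of_nat (x mod Q) / of_nat Q))
    = exp (- 2 * complex_of_real pi * \<i> * (of_nat w * of_nat x / of_nat Q))"
proof -
  have "(of_nat x :: complex) = of_nat Q * of_nat (x div Q) + of_nat (x mod Q)"
    by (metis mult_div_mod_eq of_nat_add of_nat_mult)
  then have "(- 2 * complex_of_real pi * \<i> * (of_nat w * of_nat (x mod Q) / of_nat Q))
    = (- 2 * complex_of_real pi * \<i> * (of_nat w * of_nat x / of_nat Q))
      + of_int (2 * int (w * (x div Q))) * (complex_of_real pi * \<i>)"
    using assms by (simp add: field_simps)
  then show ?thesis
    \<comment> \<open>Reducing \<open>x\<close> drops \<open>x div Q\<close> full periods, each of
      which shifts the exponent by \<open>w\<close> times 2 pi i.\<close>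
    unfolding exp_eq by (intro exI[of _ "int (w * (x div Q))"]) (simp add: algebra_simps)
qed

text \<open>The wrap-around in \<open>grid_add\<close> is invisible to the exponential by
  periodicity, so only additivity of the exponent remains.\<close>

lemma grid_character_add:
  assumes "Q \<ge> 1" "M \<ge> 1"
  shows "grid_character Q M \<omega> (grid_add Q M p q) = grid_character Q M \<omega> p * grid_character Q M \<omega> q"
proof -
  have "grid_character Q M \<omega> (grid_add Q M p q) =
      exp (- 2 * complex_of_real pi * \<i> * (of_nat (fst \<omega>) * of_nat (fst p + fst q) / of_nat Q))
    * exp (- 2 * complex_of_real pi * \<i> * (of_nat (snd \<omega>) * of_nat (snd p + snd q) / of_nat M))"
    unfolding grid_character_def grid_add_def fst_conv snd_conv distrib_left exp_add
    by (simp only: exp_two_pi_mod[OF assms(1)] exp_two_pi_mod[OF assms(2)])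
  also have "\<dots> = grid_character Q M \<omega> p * grid_character Q M \<omega> q"
    unfolding grid_character_def exp_add[symmetric]
    by (simp add: algebra_simps add_divide_distrib)
  finally show ?thesis .
qed

text \<open>The exponent is purely imaginary, so conjugation negates it.\<close>

lemma grid_character_mult_cnj: "grid_character Q M \<omega> p * cnj (grid_character Q M \<omega> p) = 1"
  by (simp add: grid_character_def exp_cnj flip: exp_add)

text \<open>After exchanging the two sums, the kernel at \<open>p\<close> splits into its value at
  the translated point times a conjugate factor in \<open>q\<close>. The inner sum then runs over a
  translate of the grid, hence is independent of \<open>q\<close>.\<close>

lemma dft_correlation:
  assumes "Q \<ge> 1" "M \<ge> 1"
  shows "of_nat (card (grid Q M)) * dft Q M (correlation Q M F) \<omega> $ n
    = dft Q M F \<omega> $ n * cnj (dft Q M F \<omega> $ n)"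
proof -
  let ?U = "grid Q M" and ?e = "grid_character Q M \<omega>"
  let ?f = "\<lambda>p. complex_of_real (F p $ n)"
  have N: "card ?U \<noteq> 0" using card_grid_pos[OF assms] by linarith
  have e: "?e p = ?e (grid_add Q M p q) * cnj (?e q)" for p q
    by (simp add: grid_character_add[OF assms] mult.assoc grid_character_mult_cnj)
  have shift: "(\<Sum>p\<in>?U. ?f (grid_add Q M p q) * ?e (grid_add Q M p q)) = dft Q M F \<omega> $ n" for q
    using sum_grid_add[of "\<lambda>p. ?f p * ?e p" Q M q]
    by (simp add: dft_nth grid_add_commute[of Q M q])
  have "of_nat (card ?U) * dft Q M (correlation Q M F) \<omega> $ n
      = (\<Sum>p\<in>?U. \<Sum>q\<in>?U. ?f q * ?f (grid_add Q M p q) * ?e p)"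
    using N by (simp add: dft_nth correlation_def sum_distrib_left sum_distrib_right)
  also have "\<dots> = (\<Sum>q\<in>?U. \<Sum>p\<in>?U. ?f q * ?f (grid_add Q M p q) * ?e p)"
    by (rule sum.swap)
  also have "\<dots> = (\<Sum>q\<in>?U. (\<Sum>p\<in>?U. ?f (grid_add Q M p q) * ?e (grid_add Q M p q))
      * (?f q * cnj (?e q)))"
  proof -
    have "?f q * ?f (grid_add Q M p q) * ?e p
        = ?f (grid_add Q M p q) * ?e (grid_add Q M p q) * (?f q * cnj (?e q))" for p q
      by (subst e[of p q]) (simp only: mult_ac)
    then show ?thesis
      by (simp only: sum_distrib_right)
  qed
  \<comment> \<open>Since \<open>F\<close> is real, conjugating its transform conjugates only the
    characters.\<close>
  also have "\<dots> = dft Q M F \<omega> $ n * cnj (dft Q M F \<omega> $ n)"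
    unfolding shift by (simp add: dft_nth sum_distrib_left)
  finally show ?thesis .
qed

text \<open>Taking moduli in \<open>dft_correlation\<close> leaves the square of the spectrum, which
  is nonnegative, so the root recovers it.\<close>

lemma spectrum_eq_sqrt_dft_correlation:
  assumes "Q \<ge> 1" "M \<ge> 1"
  shows "spectrum Q M F \<omega> $ n
    = sqrt (real (card (grid Q M)) * cmod (dft Q M (correlation Q M F) \<omega> $ n))"
proof -
  have "real (card (grid Q M)) * cmod (dft Q M (correlation Q M F) \<omega> $ n)
      = cmod (dft Q M F \<omega> $ n * cnj (dft Q M F \<omega> $ n))"
    unfolding dft_correlation[OF assms, symmetric] by (simp add: norm_mult)
  then show ?thesis
    by (simp add: spectrum_def norm_mult)
qed

theorem proposition4p1:
  fixes Q M :: nat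
    and F :: "nat \<times> nat \<Rightarrow> real ^ 'k"
    and m :: "real ^ 'k"
    and C :: "nat \<times> nat \<Rightarrow> real ^ 'k ^ 'k"
  assumes "Q \<ge> 1" and "M \<ge> 1"
    and "m = gauss_mean Q M F" and "C = gauss_cov Q M F"
  shows "gram Q M F = C (0, 0) + (columnvector m :: real ^ 1 ^ 'k) ** transpose (columnvector m)
    \<and> centred_gram Q M F = C (0, 0)
    \<and> (\<forall>p\<in>grid Q M. correlation Q M F p = diag (C p) + m * m)
    \<and> (\<forall>\<omega>\<in>grid Q M. spectrum Q M F \<omega> =
          (\<chi> n. sqrt (real (card (grid Q M)) * cmod (dft Q M (correlation Q M F) \<omega> $ n))))"
proof (intro conjI ballI)
  note QM = assms(1,2) and mC = assms(3,4)
  have "gram Q M F $ i $ j = (C (0, 0) + (columnvector m :: real ^ 1 ^ 'k) ** transpose (columnvector m)) $ i $ j"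
    for i j
    \<comment> \<open>At shift zero the uncentred sum in \<open>gauss_cov_nth\<close> is the Gram
      sum, and the rank-one matrix restores the subtracted product of means.\<close>
    by (simp add: mC gauss_cov_nth[OF QM] columnvector_mult_transpose_nth gram_def grid_add_zero
        cong: sum.cong)
  then show "gram Q M F = C (0, 0) + (columnvector m :: real ^ 1 ^ 'k) ** transpose (columnvector m)"
    by (simp add: vec_eq_iff)
  show "centred_gram Q M F = C (0, 0)"
    by (simp add: mC gauss_cov_zero)
  show "correlation Q M F p = diag (C p) + m * m" for p
    by (simp add: vec_eq_iff mC diag_def gauss_cov_nth[OF QM] correlation_def)
  show "spectrum Q M F \<omega> =
      (\<chi> n. sqrt (real (card (grid Q M)) * cmod (dft Q M (correlation Q M F) \<omega> $ n)))" for \<omega>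
    by (simp add: vec_eq_iff spectrum_eq_sqrt_dft_correlation[OF QM])
qed

end
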